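(* Let $V\in\mathcal O^{\mathrm{int}}$ and let $B$ and $B'$ be perfect bases of $V$. Assume that there is a bijection $\varphi:B\to B'$ and a partial order $\leqslant$ on $B$ such that $\varphi(b)\in b+\sum_{c>b}\mathbb C\,c$ for each $b\in B$. Then the map $\varphi$ is a crystal isomorphism $B\xrightarrow{\sim}B'$.
   Context: $\mathfrak g$ is the Kac–Moody algebra over $\mathbb C$, with Chevalley generators $e_i,f_i$ $(i\in I)$, simple roots $\alpha_i$, coroots $\alpha_i^\vee$ and weight lattice $\mathrm X$, attached to a quiver $I$ which is a finite disjoint union of quivers of type $A_\infty$ (doubly infinite), or of cyclic quivers of type $A_{e-1}^{(1)}$. $\mathcal O^{\mathrm{int}}$ is the category of $\mathfrak g$-modules $V=\bigoplus_{\omega\in \mathrm X}V_\omega$ with finite-dimensional weight spaces, locally nilpotent action of all $e_i,f_i$, and set of weights contained in $S+\sum_i\mathbb Z_{\le0}\alpha_i$ for some finite $S\subset \mathrm X$. For $x\in V$, $\ell_i(x)=\max\{k\in\mathbb N:e_i^kx\neq0\}$ ($\ell_i(0)=-\infty$), and $V_i^{<k}=\{x\in V:\ell_i(x)<k\}$. A basis $B$ of $V$ is perfect if: (a) $B=\bigsqcup_\mu(B\cap V_\mu)$; (b) for each $i\in I$ there is a map $\mathbf e_i:B\to B\sqcup\{0\}$ such that for $b\in B$: if $\ell_i(b)=0$ then $\mathbf e_ib=0$; if $\ell_i(b)>0$ then $\mathbf e_ib\in B$ and $e_ib\in\mathbb C^\times\mathbf e_ib+V_i^{<\ell_i(b)-1}$;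 (c) if $\mathbf e_ib=\mathbf e_ib'\neq0$ with $b,b'\in B$ then $b=b'$. A perfect basis defines an abstract crystal: $\tilde e_i=\mathbf e_i$; $\tilde f_ib=b'$ if $\mathbf e_ib'=b$ for some $b'\in B$ and $\tilde f_ib=0$ otherwise; $\varepsilon_i=\ell_i$; $\mathrm{wt}(b)$ is the weight of $b$; $\varphi_i(b)=\varepsilon_i(b)+\langle\alpha_i^\vee,\mathrm{wt}(b)\rangle$. A crystal isomorphism $B\to B'$ is a bijection (extended by $0\mapsto0$) commuting with $\mathrm{wt},\varepsilon_i,\varphi_i,\tilde e_i,\tilde f_i$ for all $i$. *)

theory Defs
  imports
    Complex_Main
    "HOL-Algebra.Free_Abelian_Groups"
    "HOL-Library.Multiset"
    "HOL-Library.Disjoint_Sets"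
    "HOL-Library.Extended"
begin

section \<open>Quivers\<close>

text \<open>A quiver is given by its arrow set; a full subquiver on a vertex set \<open>C\<close> has arrow set
  \<open>Q \<inter> C \<times> C\<close>.  No quiver below has two parallel arrows (for \<open>e = 2\<close> the cyclic quiver has
  one arrow in each direction).\<close>

definition type_A_infinity :: "'i set \<Rightarrow> ('i \<times> 'i) set \<Rightarrow> bool" where
  "type_A_infinity C Q \<longleftrightarrow>
     (\<exists>v :: int \<Rightarrow> 'i. bij_betw v UNIV C \<and> Q = {(v n, v (n + 1)) | n. True})"

definition type_A_cyclic :: "nat \<Rightarrow> 'i set \<Rightarrow> ('i \<times> 'i) set \<Rightarrow> bool" where
  "type_A_cyclic e C Q \<longleftrightarrow>
     (\<exists>v :: nat \<Rightarrow> 'i. bij_betw v {..<e} C \<and> Q = {(v n, v (Suc n mod e)) | n. n < e})"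

text \<open>The vertex set is the whole type \<open>'i\<close>.\<close>

definition union_of_type_A :: "('i \<times> 'i) set \<Rightarrow> bool" where
  "union_of_type_A Q \<longleftrightarrow>
     (\<exists>P. finite P \<and> partition_on UNIV P \<and> Q \<subseteq> (\<Union>C\<in>P. C \<times> C) \<and>
       (\<forall>C\<in>P. type_A_infinity C (Q \<inter> C \<times> C) \<or>
                (\<exists>e\<ge>2. type_A_cyclic e C (Q \<inter> C \<times> C))))"

definition cartan_entry :: "('i \<times> 'i) set \<Rightarrow> 'i \<Rightarrow> 'i \<Rightarrow> int" where
  "cartan_entry Q i j =
     (if i = j then 2 else 0) - of_bool ((i, j) \<in> Q) - of_bool ((j, i) \<in> Q)"

section \<open>Cartan data\<close>

record ('i, 'x, 'y) cartan_data =
  arrows :: "('i \<times> 'i) set"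
  pairing :: "'y \<Rightarrow> 'x \<Rightarrow> int"
  root :: "'i \<Rightarrow> 'x"
  coroot :: "'i \<Rightarrow> 'y"

text \<open>\<open>'x\<close> is the weight lattice \<open>X\<close> and \<open>'y\<close> the coweight lattice.  The coroots are linearly
  independent because fundamental weights exist.  The simple roots need not be independent, so
  that in affine type \<open>X\<close> may be the span of the fundamental weights or may also contain the
  imaginary root.  Only nondegeneracy
  of the pairing is required, not perfectness: for \<open>A\<^sub>\<infinity>\<close> the lattice \<open>X\<close> has infinite rank, and
  the span of the coroots is then strictly smaller than the dual of the span of the fundamental
  weights.\<close>

definition cartan_datum ::
    "('i, 'x :: ab_group_add, 'y :: ab_group_add) cartan_data \<Rightarrow> bool" where
  "cartan_datum D \<longleftrightarrow>
     union_of_type_A (arrows D) \<and>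
     (\<exists>S :: 'x set. free_Abelian_group S \<cong>
        \<lparr>carrier = (UNIV :: 'x set), monoid.mult = (+), one = 0\<rparr>) \<and>
     (\<forall>h h' \<omega>. pairing D (h + h') \<omega> = pairing D h \<omega> + pairing D h' \<omega>) \<and>
     (\<forall>h \<omega> \<omega>'. pairing D h (\<omega> + \<omega>') = pairing D h \<omega> + pairing D h \<omega>') \<and>
     (\<forall>h. (\<forall>\<omega>. pairing D h \<omega> = 0) \<longrightarrow> h = 0) \<and>
     (\<forall>\<omega>. (\<forall>h. pairing D h \<omega> = 0) \<longrightarrow> \<omega> = 0) \<and>
     (\<forall>i j. pairing D (coroot D i) (root D j) = cartan_entry (arrows D) i j) \<and>
     (\<forall>i. \<exists>\<Lambda>. \<forall>j. pairing D (coroot D j) \<Lambda> = (if i = j then 1 else 0))"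

section \<open>Complex Lie algebras, presentations, representations\<close>

record 'a lie_ops =
  lcarrier :: "'a set"
  lzero :: 'a
  ladd :: "'a \<Rightarrow> 'a \<Rightarrow> 'a"
  lscale :: "complex \<Rightarrow> 'a \<Rightarrow> 'a"
  lbracket :: "'a \<Rightarrow> 'a \<Rightarrow> 'a"

definition lie_algebra :: "'a lie_ops \<Rightarrow> bool" where
  "lie_algebra L \<longleftrightarrow>
     lzero L \<in> lcarrier L \<and>
     (\<forall>x\<in>lcarrier L. \<forall>y\<in>lcarrier L. ladd L x y \<in> lcarrier L \<and> lbracket L x y \<in> lcarrier L) \<and>
     (\<forall>a. \<forall>x\<in>lcarrier L. lscale L a x \<in> lcarrier L) \<and>
     (\<forall>x\<in>lcarrier L. \<forall>y\<in>lcarrier L. \<forall>z\<in>lcarrier L.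
        ladd L (ladd L x y) z = ladd L x (ladd L y z)) \<and>
     (\<forall>x\<in>lcarrier L. \<forall>y\<in>lcarrier L. ladd L x y = ladd L y x) \<and>
     (\<forall>x\<in>lcarrier L. ladd L (lzero L) x = x) \<and>
     (\<forall>x\<in>lcarrier L. ladd L x (lscale L (- 1) x) = lzero L) \<and>
     (\<forall>a. \<forall>x\<in>lcarrier L. \<forall>y\<in>lcarrier L.
        lscale L a (ladd L x y) = ladd L (lscale L a x) (lscale L a y)) \<and>
     (\<forall>a b. \<forall>x\<in>lcarrier L. lscale L (a + b) x = ladd L (lscale L a x) (lscale L b x)) \<and>
     (\<forall>a b. \<forall>x\<in>lcarrier L. lscale L (a * b) x = lscale L a (lscale L b x)) \<and>
     (\<forall>x\<in>lcarrier L. lscale L 1 x = x) \<and>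
     (\<forall>x\<in>lcarrier L. \<forall>y\<in>lcarrier L. \<forall>z\<in>lcarrier L.
        lbracket L (ladd L x y) z = ladd L (lbracket L x z) (lbracket L y z)) \<and>
     (\<forall>x\<in>lcarrier L. \<forall>y\<in>lcarrier L. \<forall>z\<in>lcarrier L.
        lbracket L x (ladd L y z) = ladd L (lbracket L x y) (lbracket L x z)) \<and>
     (\<forall>a. \<forall>x\<in>lcarrier L. \<forall>y\<in>lcarrier L.
        lbracket L (lscale L a x) y = lscale L a (lbracket L x y)) \<and>
     (\<forall>a. \<forall>x\<in>lcarrier L. \<forall>y\<in>lcarrier L.
        lbracket L x (lscale L a y) = lscale L a (lbracket L x y)) \<and>
     (\<forall>x\<in>lcarrier L. lbracket L x x = lzero L) \<and>
     (\<forall>x\<in>lcarrier L. \<forall>y\<in>lcarrier L. \<forall>z\<in>lcarrier L.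
        ladd L (lbracket L x (lbracket L y z))
          (ladd L (lbracket L y (lbracket L z x)) (lbracket L z (lbracket L x y))) = lzero L)"

datatype 'g lie_expr =
    Gen 'g
  | Zero
  | Add "'g lie_expr" "'g lie_expr"
  | Scale complex "'g lie_expr"
  | Bracket "'g lie_expr" "'g lie_expr"

text \<open>The least congruence that contains the given relations and makes the quotient a Lie
  algebra; the quotient is the Lie algebra presented by the generators \<open>'g\<close> and the relations.\<close>

inductive lie_eq :: "('g lie_expr \<Rightarrow> 'g lie_expr \<Rightarrow> bool) \<Rightarrow> 'g lie_expr \<Rightarrow> 'g lie_expr \<Rightarrow> bool"
  for R where
  rel: "R x y \<Longrightarrow> lie_eq R x y"
| refl: "lie_eq R x x"
| sym: "lie_eq R x y \<Longrightarrow> lie_eq R y x"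
| trans: "lie_eq R x y \<Longrightarrow> lie_eq R y z \<Longrightarrow> lie_eq R x z"
| add_cong: "lie_eq R x x' \<Longrightarrow> lie_eq R y y' \<Longrightarrow> lie_eq R (Add x y) (Add x' y')"
| scale_cong: "lie_eq R x x' \<Longrightarrow> lie_eq R (Scale a x) (Scale a x')"
| bracket_cong: "lie_eq R x x' \<Longrightarrow> lie_eq R y y' \<Longrightarrow> lie_eq R (Bracket x y) (Bracket x' y')"
| add_assoc: "lie_eq R (Add (Add x y) z) (Add x (Add y z))"
| add_comm: "lie_eq R (Add x y) (Add y x)"
| add_zero: "lie_eq R (Add Zero x) x"
| add_neg: "lie_eq R (Add x (Scale (- 1) x)) Zero"
| scale_add: "lie_eq R (Scale a (Add x y)) (Add (Scale a x) (Scale a y))"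
| add_scale: "lie_eq R (Scale (a + b) x) (Add (Scale a x) (Scale b x))"
| scale_scale: "lie_eq R (Scale (a * b) x) (Scale a (Scale b x))"
| scale_one: "lie_eq R (Scale 1 x) x"
| bracket_add_left: "lie_eq R (Bracket (Add x y) z) (Add (Bracket x z) (Bracket y z))"
| bracket_add_right: "lie_eq R (Bracket x (Add y z)) (Add (Bracket x y) (Bracket x z))"
| bracket_scale_left: "lie_eq R (Bracket (Scale a x) y) (Scale a (Bracket x y))"
| bracket_scale_right: "lie_eq R (Bracket x (Scale a y)) (Scale a (Bracket x y))"
| bracket_self: "lie_eq R (Bracket x x) Zero"
| jacobi: "lie_eq R (Add (Bracket x (Bracket y z))
                        (Add (Bracket y (Bracket z x)) (Bracket z (Bracket x y)))) Zero"

definition lie_class ::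
    "('g lie_expr \<Rightarrow> 'g lie_expr \<Rightarrow> bool) \<Rightarrow> 'g lie_expr \<Rightarrow> 'g lie_expr set" where
  "lie_class R x = {y. lie_eq R x y}"

definition presented_lie_algebra ::
    "('g lie_expr \<Rightarrow> 'g lie_expr \<Rightarrow> bool) \<Rightarrow> 'g lie_expr set lie_ops" where
  "presented_lie_algebra R =
     \<lparr>lcarrier = range (lie_class R),
      lzero = lie_class R Zero,
      ladd = (\<lambda>X Y. \<Union>x\<in>X. \<Union>y\<in>Y. lie_class R (Add x y)),
      lscale = (\<lambda>a X. \<Union>x\<in>X. lie_class R (Scale a x)),
      lbracket = (\<lambda>X Y. \<Union>x\<in>X. \<Union>y\<in>Y. lie_class R (Bracket x y))\<rparr>"

lemma lie_class_eq_iff: "lie_class R x = lie_class R y \<longleftrightarrow> lie_eq R x y"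
  unfolding lie_class_def by (auto intro: lie_eq.refl lie_eq.sym lie_eq.trans)

lemma presented_lie_algebra_simps:
  "lcarrier (presented_lie_algebra R) = range (lie_class R)"
  "lzero (presented_lie_algebra R) = lie_class R Zero"
  "ladd (presented_lie_algebra R) (lie_class R x) (lie_class R y) = lie_class R (Add x y)"
  "lscale (presented_lie_algebra R) a (lie_class R x) = lie_class R (Scale a x)"
  "lbracket (presented_lie_algebra R) (lie_class R x) (lie_class R y) = lie_class R (Bracket x y)"
  unfolding presented_lie_algebra_def lie_class_def
  by (auto intro: lie_eq.intros(2-7))

lemma lie_algebra_presented_lie_algebra: "lie_algebra (presented_lie_algebra R)"
  unfolding lie_algebra_def
  by (simp add: presented_lie_algebra_simps lie_class_eq_iff lie_eq.intros(8-) rangeI)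

record ('a, 'v) lie_rep =
  vscale :: "complex \<Rightarrow> 'v \<Rightarrow> 'v"
  act :: "'a \<Rightarrow> 'v \<Rightarrow> 'v"

definition lie_module :: "'a lie_ops \<Rightarrow> ('a, 'v :: ab_group_add) lie_rep \<Rightarrow> bool" where
  "lie_module L M \<longleftrightarrow>
     vector_space (vscale M) \<and>
     (\<forall>x\<in>lcarrier L. Vector_Spaces.linear (vscale M) (vscale M) (act M x)) \<and>
     (\<forall>x\<in>lcarrier L. \<forall>y\<in>lcarrier L. \<forall>v. act M (ladd L x y) v = act M x v + act M y v) \<and>
     (\<forall>a. \<forall>x\<in>lcarrier L. \<forall>v. act M (lscale L a x) v = vscale M a (act M x v)) \<and>
     (\<forall>x\<in>lcarrier L. \<forall>y\<in>lcarrier L. \<forall>v.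
        act M (lbracket L x y) v = act M x (act M y v) - act M y (act M x v))"

section \<open>The Kac--Moody algebra\<close>

datatype ('i, 'y) km_gen = E 'i | F 'i | H 'y

text \<open>The generator \<open>H h\<close> is the element \<open>1 \<otimes> h\<close> of the Cartan subalgebra, which is the
  complexified coweight lattice; hence the relation \<open>H_add\<close>.\<close>

inductive km_rel ::
    "('i, 'x :: ab_group_add, 'y :: ab_group_add) cartan_data \<Rightarrow>
     ('i, 'y) km_gen lie_expr \<Rightarrow> ('i, 'y) km_gen lie_expr \<Rightarrow> bool"
  for D where
  H_add: "km_rel D (Gen (H (h + h'))) (Add (Gen (H h)) (Gen (H h')))"
| H_H: "km_rel D (Bracket (Gen (H h)) (Gen (H h'))) Zero"
| H_E: "km_rel D (Bracket (Gen (H h)) (Gen (E i)))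
                 (Scale (of_int (pairing D h (root D i))) (Gen (E i)))"
| H_F: "km_rel D (Bracket (Gen (H h)) (Gen (F i)))
                 (Scale (- of_int (pairing D h (root D i))) (Gen (F i)))"
| E_F: "km_rel D (Bracket (Gen (E i)) (Gen (F j)))
                 (if i = j then Gen (H (coroot D i)) else Zero)"
| serre_E: "i \<noteq> j \<Longrightarrow>
    km_rel D ((Bracket (Gen (E i)) ^^ nat (1 - cartan_entry (arrows D) i j)) (Gen (E j))) Zero"
| serre_F: "i \<noteq> j \<Longrightarrow>
    km_rel D ((Bracket (Gen (F i)) ^^ nat (1 - cartan_entry (arrows D) i j)) (Gen (F j))) Zero"

type_synonym ('i, 'y) km_elem = "('i, 'y) km_gen lie_expr set"

definition kac_moody ::
    "('i, 'x :: ab_group_add, 'y :: ab_group_add) cartan_data \<Rightarrow> ('i, 'y) km_elem lie_ops" where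
  "kac_moody D = presented_lie_algebra (km_rel D)"

definition chevalley_e ::
    "('i, 'x :: ab_group_add, 'y :: ab_group_add) cartan_data \<Rightarrow> 'i \<Rightarrow> ('i, 'y) km_elem" where
  "chevalley_e D i = lie_class (km_rel D) (Gen (E i))"

definition chevalley_f ::
    "('i, 'x :: ab_group_add, 'y :: ab_group_add) cartan_data \<Rightarrow> 'i \<Rightarrow> ('i, 'y) km_elem" where
  "chevalley_f D i = lie_class (km_rel D) (Gen (F i))"

definition cartan_h ::
    "('i, 'x :: ab_group_add, 'y :: ab_group_add) cartan_data \<Rightarrow> 'y \<Rightarrow> ('i, 'y) km_elem" where
  "cartan_h D h = lie_class (km_rel D) (Gen (H h))"

section \<open>Integrable modules in category O\<close>

definition weight_space ::
    "('i, 'x :: ab_group_add, 'y :: ab_group_add) cartan_data \<Rightarrow>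
     (('i, 'y) km_elem, 'v :: ab_group_add) lie_rep \<Rightarrow> 'x \<Rightarrow> 'v set" where
  "weight_space D M \<omega> = {v. \<forall>h. act M (cartan_h D h) v = vscale M (of_int (pairing D h \<omega>)) v}"

text \<open>The last clause: every weight \<open>\<omega>\<close> is \<open>s - (\<Sum>i. n i \<cdot> \<alpha> i)\<close> with \<open>s \<in> S\<close> and finitely
  supported \<open>n\<close> with values in the natural numbers, written as a multiset.\<close>

definition O_int ::
    "('i, 'x :: ab_group_add, 'y :: ab_group_add) cartan_data \<Rightarrow>
     (('i, 'y) km_elem, 'v :: ab_group_add) lie_rep set" where
  "O_int D = {M.
     lie_module (kac_moody D) M \<and>
     (\<forall>v. \<exists>!c. (\<forall>\<omega>. c \<omega> \<in> weight_space D M \<omega>) \<and> finite {\<omega>. c \<omega> \<noteq> 0} \<and>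
              v = (\<Sum>\<omega> | c \<omega> \<noteq> 0. c \<omega>)) \<and>
     (\<forall>\<omega>. \<exists>T. finite T \<and> module.span (vscale M) T = weight_space D M \<omega>) \<and>
     (\<forall>i v. \<exists>k. (act M (chevalley_e D i) ^^ k) v = 0) \<and>
     (\<forall>i v. \<exists>k. (act M (chevalley_f D i) ^^ k) v = 0) \<and>
     (\<exists>S. finite S \<and> (\<forall>\<omega>. weight_space D M \<omega> \<noteq> {0} \<longrightarrow>
        (\<exists>s\<in>S. \<exists>n :: 'i multiset. \<omega> = s - (\<Sum>i\<in>#n. root D i))))}"

section \<open>Perfect bases\<close>

text \<open>The maximum exists when \<open>e\<^sub>i\<close> is locally nilpotent.\<close>

definition ell ::
    "('i, 'x :: ab_group_add, 'y :: ab_group_add) cartan_data \<Rightarrow>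
     (('i, 'y) km_elem, 'v :: ab_group_add) lie_rep \<Rightarrow> 'i \<Rightarrow> 'v \<Rightarrow> int extended" where
  "ell D M i x =
     (if x = 0 then -\<infinity>
      else Fin (int (Max {k. (act M (chevalley_e D i) ^^ k) x \<noteq> 0})))"

definition V_less ::
    "('i, 'x :: ab_group_add, 'y :: ab_group_add) cartan_data \<Rightarrow>
     (('i, 'y) km_elem, 'v :: ab_group_add) lie_rep \<Rightarrow> 'i \<Rightarrow> int extended \<Rightarrow> 'v set" where
  "V_less D M i k = {x. ell D M i x < k}"

text \<open>The maps \<open>\<e>\<^sub>i : B \<rightarrow> B \<squnion> {0}\<close> are part of the data; \<open>0\<close> is the zero vector, which is not in
  the basis \<open>B\<close>.  Their values outside \<open>B\<close> are irrelevant.\<close>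

definition perfect_basis ::
    "('i, 'x :: ab_group_add, 'y :: ab_group_add) cartan_data \<Rightarrow>
     (('i, 'y) km_elem, 'v :: ab_group_add) lie_rep \<Rightarrow> 'v set \<Rightarrow> ('i \<Rightarrow> 'v \<Rightarrow> 'v) \<Rightarrow> bool" where
  "perfect_basis D M B \<e> \<longleftrightarrow>
     \<not> module.dependent (vscale M) B \<and> module.span (vscale M) B = UNIV \<and>
     B = (\<Union>\<mu>. B \<inter> weight_space D M \<mu>) \<and>
     disjoint_family (\<lambda>\<mu>. B \<inter> weight_space D M \<mu>) \<and>
     (\<forall>i. \<forall>b\<in>B. \<e> i b \<in> B \<union> {0} \<and>
        (ell D M i b = 0 \<longrightarrow> \<e> i b = 0) \<and>
        (ell D M i b > 0 \<longrightarrow> \<e> i b \<in> B \<and>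
           (\<exists>a v. a \<noteq> 0 \<and> v \<in> V_less D M i (ell D M i b - 1) \<and>
              act M (chevalley_e D i) b = vscale M a (\<e> i b) + v))) \<and>
     (\<forall>i. \<forall>b\<in>B. \<forall>b'\<in>B. \<e> i b = \<e> i b' \<and> \<e> i b \<noteq> 0 \<longrightarrow> b = b')"

section \<open>Crystals\<close>

record ('i, 'x, 'b) crystal =
  elts :: "'b set"
  wt :: "'b \<Rightarrow> 'x"
  eps :: "'i \<Rightarrow> 'b \<Rightarrow> int extended"
  phi :: "'i \<Rightarrow> 'b \<Rightarrow> int extended"
  e_tilde :: "'i \<Rightarrow> 'b \<Rightarrow> 'b"
  f_tilde :: "'i \<Rightarrow> 'b \<Rightarrow> 'b"

definition basis_wt ::
    "('i, 'x :: ab_group_add, 'y :: ab_group_add) cartan_data \<Rightarrow>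
     (('i, 'y) km_elem, 'v :: ab_group_add) lie_rep \<Rightarrow> 'v \<Rightarrow> 'x" where
  "basis_wt D M b = (THE \<mu>. b \<in> weight_space D M \<mu>)"

definition crystal_of ::
    "('i, 'x :: ab_group_add, 'y :: ab_group_add) cartan_data \<Rightarrow>
     (('i, 'y) km_elem, 'v :: ab_group_add) lie_rep \<Rightarrow> 'v set \<Rightarrow> ('i \<Rightarrow> 'v \<Rightarrow> 'v) \<Rightarrow>
     ('i, 'x, 'v) crystal" where
  "crystal_of D M B \<e> =
     \<lparr>elts = B,
      wt = basis_wt D M,
      eps = ell D M,
      phi = (\<lambda>i b. ell D M i b + Fin (pairing D (coroot D i) (basis_wt D M b))),
      e_tilde = \<e>,
      f_tilde = (\<lambda>i b. if \<exists>b'\<in>B. \<e> i b' = b then THE b'. b' \<in> B \<and> \<e> i b' = b else 0)\<rparr>"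

text \<open>The element \<open>0\<close> adjoined to a crystal is the \<open>0\<close> of the type \<open>'b\<close>, assumed not to be an
  element of the crystal.\<close>

definition extend_by_0 :: "('b :: zero \<Rightarrow> 'b) \<Rightarrow> 'b \<Rightarrow> 'b" where
  "extend_by_0 \<phi> b = (if b = 0 then 0 else \<phi> b)"

definition crystal_iso ::
    "('i, 'x, 'b :: zero) crystal \<Rightarrow> ('i, 'x, 'b) crystal \<Rightarrow> ('b \<Rightarrow> 'b) \<Rightarrow> bool" where
  "crystal_iso C C' \<phi> \<longleftrightarrow>
     0 \<notin> elts C \<and> 0 \<notin> elts C' \<and>
     bij_betw \<phi> (elts C) (elts C') \<and>
     (\<forall>b\<in>elts C. wt C' (\<phi> b) = wt C b \<and>
        (\<forall>i. eps C' i (\<phi> b) = eps C i b \<and>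
             phi C' i (\<phi> b) = phi C i b \<and>
             e_tilde C' i (\<phi> b) = extend_by_0 \<phi> (e_tilde C i b) \<and>
             f_tilde C' i (\<phi> b) = extend_by_0 \<phi> (f_tilde C i b)))"

end

theory Submission
  imports Defs
begin

text \<open>Two ideas carry the proof.  First, in a perfect basis \<open>B\<close> the power \<open>e\<^sub>i\<^sup>m\<close> maps the elements
  \<open>b\<close> with \<open>\<ell>\<^sub>i(b) = m\<close> to nonzero multiples of pairwise distinct elements of \<open>B\<close>; hence \<open>\<ell>\<^sub>i(x)\<close> is the
  maximum of \<open>\<ell>\<^sub>i\<close> over the support of \<open>x\<close>.  As \<open>\<phi>\<close> is unitriangular on finite weight blocks, so is
  its inverse, and therefore \<open>\<ell>\<^sub>i(\<phi>(b)) = \<ell>\<^sub>i(b)\<close>.  Secondly, write \<open>\<e>'\<^sub>i \<phi>(b) = \<phi>(d)\<close>.  Comparing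
  leading terms of \<open>e\<^sub>i \<phi>(b)\<close> shows that \<open>d\<close> lies in \<open>\<e>\<^sub>i(B)\<close> and that \<open>\<e>\<^sub>i b\<close> occurs in \<open>\<phi>(d)\<close>, so that
  \<open>d \<le> \<e>\<^sub>i b\<close>.  Thus \<open>\<e>\<^sub>i b \<mapsto> d\<close> is an injective decreasing self-map of a finite set, which
  forces \<open>d = \<e>\<^sub>i b\<close>.\<close>

section \<open>Bases adapted to a locally nilpotent operator\<close>

text \<open>Pigeonhole: if \<open>f\<close> moved \<open>x\<close>, it would send \<open>x\<close>
  and everything strictly below it injectively into the set of elements strictly below
  \<open>x\<close>, which has one element fewer.\<close>

lemma injective_decreasing_eq:
  assumes fin: "finite S" and maps: "f ` S \<subseteq> S" and inj: "inj_on f S"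
    and decr: "\<And>x. x \<in> S \<Longrightarrow> (f x, x) \<in> r" and tr: "trans r" and anti: "antisym r"
    and x: "x \<in> S"
  shows "f x = x"
proof (rule ccontr)
  assume neq: "f x \<noteq> x"
  define L where "L = {y \<in> S. (y, x) \<in> r \<and> y \<noteq> x}"
  have below: "f ` insert x L \<subseteq> L"
  proof (rule image_subsetI)
    fix y assume y: "y \<in> insert x L"
    then have yS: "y \<in> S" using x by (auto simp: L_def)
    have fyS: "f y \<in> S" using maps yS by auto
    show "f y \<in> L"
    proof (cases "y = x")
      case True
      then show ?thesis using decr[OF x] neq fyS by (auto simp: L_def)
    next
      case False
      with y have yx: "(y, x) \<in> r" by (auto simp: L_def)
      with decr[OF yS] tr have "(f y, x) \<in> r" by (meson transD)
      moreover have "f y \<noteq> x" using decr[OF yS] yx anti False by (metis antisymD)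
      ultimately show ?thesis using fyS by (auto simp: L_def)
    qed
  qed
  have finL: "finite L" and notin: "x \<notin> L" using fin by (auto simp: L_def)
  have "inj_on f (insert x L)"
    by (rule inj_on_subset[OF inj]) (use x in \<open>auto simp: L_def\<close>)
  then have "card (insert x L) \<le> card L"
    using below finL by (rule card_inj_on_le)
  then show False using finL notin by simp
qed

text \<open>A linear operator \<open>e\<close> stands for one of the \<open>e\<^sub>i\<close>, and \<open>t\<close> for the map \<open>\<e>\<^sub>i\<close>; the condition
  \<open>\<ell>\<^sub>i(b) = m + 1\<close> is spelled out as \<open>e\<^sup>m\<^sup>+\<^sup>1 b \<noteq> 0 = e\<^sup>m\<^sup>+\<^sup>2 b\<close>.\<close>

locale adapted_basis = vector_space scale
  for scale :: "'a :: field \<Rightarrow> 'v :: ab_group_add \<Rightarrow> 'v" (infixr "*s" 75) +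
  fixes e :: "'v \<Rightarrow> 'v" and B :: "'v set" and t :: "'v \<Rightarrow> 'v"
  assumes linear_e: "Vector_Spaces.linear scale scale e"
    and nilpotent: "\<exists>n. (e ^^ n) v = 0"
    and indep: "independent B"
    and spans: "span B = UNIV"
    and top: "b \<in> B \<Longrightarrow> e b = 0 \<Longrightarrow> t b = 0"
    and step: "b \<in> B \<Longrightarrow> (e ^^ Suc m) b \<noteq> 0 \<Longrightarrow> (e ^^ Suc (Suc m)) b = 0 \<Longrightarrow>
      t b \<in> B \<and> (\<exists>a. a \<noteq> 0 \<and> (e ^^ m) (e b - a *s t b) = 0)"
    and t_inj: "b \<in> B \<Longrightarrow> b' \<in> B \<Longrightarrow> t b = t b' \<Longrightarrow> t b \<noteq> 0 \<Longrightarrow> b = b'"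
begin

section \<open>Coordinates with respect to the basis\<close>

abbreviation coef :: "'v \<Rightarrow> 'v \<Rightarrow> 'a" where "coef \<equiv> representation B"

lemma linear_funpow: "Vector_Spaces.linear scale scale (e ^^ n)"
proof (induction n)
  case 0
  show ?case using linear_id by (simp add: id_def)
next
  case (Suc n)
  then show ?case using Vector_Spaces.linear_compose[OF Suc linear_e] by (simp add: comp_def)
qed

sublocale funpow: Vector_Spaces.linear scale scale "e ^^ n" for n
  by (rule linear_funpow)

sublocale op: Vector_Spaces.linear scale scale e
  by (rule linear_e)

lemma funpow_eq_0_mono: "(e ^^ m) v = 0 \<Longrightarrow> m \<le> n \<Longrightarrow> (e ^^ n) v = 0"
  by (metis comp_apply funpow.zero funpow_add le_add_diff_inverse2)

lemma zero_notin: "0 \<notin> B"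
  using indep dependent_zero by blast

lemma coef_simps [simp]:
  "coef (x + y) b = coef x b + coef y b"
  "coef (x - y) b = coef x b - coef y b"
  "coef (a *s x) b = a * coef x b"
  "coef 0 b = 0"
  using spans by (simp_all add: representation_add[OF indep] representation_diff[OF indep]
      representation_scale[OF indep] representation_zero)

lemma coef_sum: "coef (\<Sum>i\<in>I. f i) b = (\<Sum>i\<in>I. coef (f i) b)"
  using spans by (subst representation_sum[OF indep]) auto

lemma coef_basis: "b \<in> B \<Longrightarrow> coef b c = (if c = b then 1 else 0)"
  by (simp add: representation_basis[OF indep])

lemma expansion: "(\<Sum>b | coef v b \<noteq> 0. coef v b *s b) = v"
  using spans by (intro sum_nonzero_representation_eq[OF indep]) auto

lemma funpow_expansion: "(e ^^ n) v = (\<Sum>b | coef v b \<noteq> 0. coef v b *s (e ^^ n) b)"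
  by (subst expansion[of v, symmetric]) (simp add: funpow.sum funpow.scale)

section \<open>Depth, strings of basis elements, and supports\<close>

lemma depth_ex:
  assumes "v \<noteq> 0"
  obtains m where "(e ^^ m) v \<noteq> 0" "(e ^^ Suc m) v = 0"
proof -
  define n where "n = (LEAST n. (e ^^ n) v = 0)"
  have n: "(e ^^ n) v = 0" unfolding n_def using nilpotent by (rule LeastI_ex)
  then obtain m where m: "n = Suc m" using assms by (cases n) auto
  then have "(e ^^ m) v \<noteq> 0" unfolding n_def by (intro not_less_Least) simp
  then show thesis using n m that by blast
qed

text \<open>Applying \<open>e ^^ m\<close> kills the error term in \<open>step\<close>, so
  \<open>t\<close> lowers the depth (the largest exponent whose power of \<open>e\<close> does not
  kill the vector) by exactly one.\<close>

lemma depth_step: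
  assumes b: "b \<in> B" and ne: "(e ^^ Suc m) b \<noteq> 0" and z: "(e ^^ Suc (Suc m)) b = 0"
  obtains a where "t b \<in> B" "a \<noteq> 0" "(e ^^ m) (e b - a *s t b) = 0"
    "(e ^^ Suc m) b = a *s (e ^^ m) (t b)" "(e ^^ m) (t b) \<noteq> 0" "(e ^^ Suc m) (t b) = 0"
proof -
  from step[OF b ne z] obtain a where tb: "t b \<in> B" and a: "a \<noteq> 0"
    and rest: "(e ^^ m) (e b - a *s t b) = 0" by blast
  have eq: "(e ^^ Suc m) b = a *s (e ^^ m) (t b)"
    using rest by (simp add: funpow.diff funpow.scale funpow_Suc_right del: funpow.simps)
  moreover from eq ne have "(e ^^ m) (t b) \<noteq> 0" by auto
  moreover have "a *s (e ^^ Suc m) (t b) = 0"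
    using z eq by (simp add: op.scale[symmetric])
  then have "(e ^^ Suc m) (t b) = 0" using a by simp
  ultimately show ?thesis using that tb a rest by blast
qed

lemma string_end:
  assumes "b \<in> B" "(e ^^ m) b \<noteq> 0" "(e ^^ Suc m) b = 0"
  shows "\<exists>a. a \<noteq> 0 \<and> (t ^^ m) b \<in> B \<and> (e ^^ m) b = a *s (t ^^ m) b"
  using assms
proof (induction m arbitrary: b)
  case 0
  then show ?case by (intro exI[of _ 1]) auto
next
  case (Suc m)
  from depth_step[OF Suc.prems] obtain a where a: "t b \<in> B" "a \<noteq> 0"
    "(e ^^ Suc m) b = a *s (e ^^ m) (t b)" "(e ^^ m) (t b) \<noteq> 0" "(e ^^ Suc m) (t b) = 0" .
  from Suc.IH[OF a(1,4,5)] obtain a' where a': "a' \<noteq> 0" "(t ^^ m) (t b) \<in> B"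
    "(e ^^ m) (t b) = a' *s (t ^^ m) (t b)" by blast
  then show ?case
    using a(2,3) by (intro exI[of _ "a * a'"]) (simp add: funpow_Suc_right del: funpow.simps)
qed

text \<open>One \<open>t\<close> is cancelled at a time: \<open>t b\<close> and \<open>t b'\<close>
  have depth one less, so they agree by induction, and \<open>t\<close> is injective where its value
  is nonzero.\<close>

lemma string_end_inj:
  assumes "b \<in> B" "(e ^^ m) b \<noteq> 0" "(e ^^ Suc m) b = 0"
    and "b' \<in> B" "(e ^^ m) b' \<noteq> 0" "(e ^^ Suc m) b' = 0"
    and "(t ^^ m) b = (t ^^ m) b'"
  shows "b = b'"
  using assms
proof (induction m arbitrary: b b')
  case 0
  then show ?case by simp
next
  case (Suc m)
  note 1 = depth_step[OF Suc.prems(1-3)] and 2 = depth_step[OF Suc.prems(4-6)]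
  have "t b = t b'"
  proof (rule Suc.IH)
    show "t b \<in> B" "(e ^^ m) (t b) \<noteq> 0" "(e ^^ Suc m) (t b) = 0" by (rule 1; assumption)+
    show "t b' \<in> B" "(e ^^ m) (t b') \<noteq> 0" "(e ^^ Suc m) (t b') = 0" by (rule 2; assumption)+
    show "(t ^^ m) (t b) = (t ^^ m) (t b')"
      using Suc.prems(7) by (simp add: funpow_Suc_right del: funpow.simps)
  qed
  moreover have "t b \<in> B" by (rule 1)
  ultimately show ?case using t_inj Suc.prems(1,4) zero_notin by metis
qed

text \<open>The support elements not killed by \<open>e ^^ n\<close> have depth exactly
  \<open>n\<close>, so their images are nonzero multiples of distinct basis elements and cannot
  cancel in \<open>(e ^^ n) x\<close>.\<close>

lemma funpow_eq_0_support_step: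
  assumes x: "(e ^^ n) x = 0" and supp: "\<And>b. coef x b \<noteq> 0 \<Longrightarrow> (e ^^ Suc n) b = 0"
    and b: "coef x b \<noteq> 0"
  shows "(e ^^ n) b = 0"
proof (rule ccontr)
  assume nb: "(e ^^ n) b \<noteq> 0"
  define S where "S = {c. coef x c \<noteq> 0 \<and> (e ^^ n) c \<noteq> 0}"
  have fin: "finite {c. coef x c \<noteq> 0}" by (rule finite_representation)
  have finS: "finite S" by (rule finite_subset[OF _ fin]) (auto simp: S_def)
  have SB: "c \<in> B" if "c \<in> S" for c
    using that representation_ne_zero by (auto simp: S_def)
  have bS: "b \<in> S" using b nb by (simp add: S_def)
  have "\<forall>c\<in>S. \<exists>a. a \<noteq> 0 \<and> (t ^^ n) c \<in> B \<and> (e ^^ n) c = a *s (t ^^ n) c"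
    using string_end SB supp by (auto simp: S_def)
  then obtain a where a: "\<And>c. c \<in> S \<Longrightarrow> a c \<noteq> 0 \<and> (t ^^ n) c \<in> B \<and> (e ^^ n) c = a c *s (t ^^ n) c"
    by metis
  have "0 = (\<Sum>c | coef x c \<noteq> 0. coef x c *s (e ^^ n) c)"
    using x funpow_expansion by metis
  also have "\<dots> = (\<Sum>c\<in>S. coef x c *s (e ^^ n) c)"
    using fin by (intro sum.mono_neutral_right) (auto simp: S_def)
  also have "\<dots> = (\<Sum>c\<in>S. (coef x c * a c) *s (t ^^ n) c)"
    using a by (intro sum.cong) auto
  \<comment> \<open>The coefficient at \<open>(t ^^ n) b\<close> isolates the contribution of
    \<open>b\<close>, because \<open>string_end_inj\<close> separates the string ends.\<close>
  finally have "0 = coef (\<Sum>c\<in>S. (coef x c * a c) *s (t ^^ n) c) ((t ^^ n) b)"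
    by (metis coef_simps(4))
  also have "\<dots> = (\<Sum>c\<in>S. if c = b then coef x c * a c else 0)"
    unfolding coef_sum
  proof (rule sum.cong[OF HOL.refl])
    fix c assume c: "c \<in> S"
    have "(t ^^ n) b = (t ^^ n) c \<longleftrightarrow> c = b"
      using string_end_inj[of c n b] c bS SB supp by (auto simp: S_def)
    then show "coef ((coef x c * a c) *s (t ^^ n) c) ((t ^^ n) b)
        = (if c = b then coef x c * a c else 0)"
      using a[OF c] by (simp add: coef_basis)
  qed
  also have "\<dots> = coef x b * a b"
    using finS bS by simp
  finally show False using b a[OF bS] by auto
qed

text \<open>Layers of depth are peeled off: some power of \<open>e\<close> kills the whole finite
  support, and \<open>funpow_eq_0_support_step\<close> lowers its exponent one by one down to
  \<open>m\<close>.\<close>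

lemma funpow_eq_0_support:
  assumes x: "(e ^^ m) x = 0" and b: "coef x b \<noteq> 0"
  shows "(e ^^ m) b = 0"
proof -
  obtain k where k: "\<And>v. (e ^^ k v) v = 0"
    using nilpotent by metis
  define N where "N = Max (k ` {b. coef x b \<noteq> 0})"
  have N: "(e ^^ N) b = 0" if "coef x b \<noteq> 0" for b
  proof (rule funpow_eq_0_mono[OF k])
    show "k b \<le> N"
      unfolding N_def by (rule Max_ge) (use that finite_representation in auto)
  qed
  have "\<forall>b. coef x b \<noteq> 0 \<longrightarrow> (e ^^ m) b = 0"
    if "\<And>b. coef x b \<noteq> 0 \<Longrightarrow> (e ^^ n) b = 0" for n
    using that
  proof (induction n)
    case 0
    then show ?case using funpow_eq_0_mono by blast
  next
    case (Suc n)
    show ?case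
    proof (cases "m \<le> n")
      case True
      then have "(e ^^ n) x = 0" using x funpow_eq_0_mono by blast
      then show ?thesis using Suc funpow_eq_0_support_step by blast
    next
      case False
      then show ?thesis using Suc.prems funpow_eq_0_mono[of "Suc n" _ m] by auto
    qed
  qed
  then show ?thesis using N b by blast
qed

text \<open>Either \<open>e c\<close> or its difference from a nonzero multiple of
  \<open>t c\<close> is killed by \<open>e ^^ m\<close>. By \<open>funpow_eq_0_support\<close> what
  is killed has no component at \<open>d\<close>, so only the leading term counts there.\<close>

lemma coef_e_nonzero_iff:
  assumes c: "c \<in> B" and z: "(e ^^ Suc (Suc m)) c = 0"
    and d: "(e ^^ m) d \<noteq> 0"
  shows "coef (e c) d \<noteq> 0 \<longleftrightarrow> (e ^^ Suc m) c \<noteq> 0 \<and> d = t c"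
proof (cases "(e ^^ Suc m) c = 0")
  case True
  then have "(e ^^ m) (e c) = 0" by (simp add: funpow_Suc_right del: funpow.simps)
  then show ?thesis using funpow_eq_0_support d True by blast
next
  case False
  from depth_step[OF c False z] obtain a where tc: "t c \<in> B" and a: "a \<noteq> 0"
    and r: "(e ^^ m) (e c - a *s t c) = 0" .
  have "coef (e c - a *s t c) d = 0" using funpow_eq_0_support[OF r] d by blast
  then have "coef (e c) d = a * coef (t c) d" by simp
  then show ?thesis using tc a False by (simp add: coef_basis)
qed

end

section \<open>Unitriangular bijections of adapted bases\<close>

text \<open>A pair in \<open>le\<close> reads from smaller to larger. The map \<open>wt\<close>
  abstracts the weight; its blocks are finite, which allows induction along \<open>le\<close> and
  counting arguments.\<close>

locale unitriangular_bases =
  dom: adapted_basis scale e B t + cod: adapted_basis scale e B' t'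
  for scale :: "'a :: field \<Rightarrow> 'v :: ab_group_add \<Rightarrow> 'v" (infixr "*s" 75)
    and e B t B' t' +
  fixes \<phi> :: "'v \<Rightarrow> 'v" and le :: "'v rel" and wt :: "'v \<Rightarrow> 'k"
  assumes bij: "bij_betw \<phi> B B'"
    and trans_le: "trans le" and antisym_le: "antisym le"
    and finite_block: "finite {c \<in> B. wt c = k}"
    and coef_diag: "b \<in> B \<Longrightarrow> dom.coef (\<phi> b) b = 1"
    and coef_triangular: "b \<in> B \<Longrightarrow> dom.coef (\<phi> b) c \<noteq> 0 \<Longrightarrow> (b, c) \<in> le \<and> wt c = wt b"
begin

lemma \<phi>_in: "b \<in> B \<Longrightarrow> \<phi> b \<in> B'"
  using bij bij_betwE by blast

lemma \<phi>_eq_iff: "b \<in> B \<Longrightarrow> c \<in> B \<Longrightarrow> \<phi> b = \<phi> c \<longleftrightarrow> b = c"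
  using bij by (auto simp: bij_betw_def inj_on_eq_iff)

text \<open>Back substitution: \<open>b\<close> is \<open>\<phi> b\<close> minus terms at elements
  \<open>c\<close> strictly above \<open>b\<close> in the same block. The induction applies to
  these, since fewer elements of the block lie above \<open>c\<close>.\<close>

lemma inverse_unitriangular:
  assumes "b \<in> B"
  shows "cod.coef b (\<phi> b) = 1 \<and> (\<forall>c\<in>B. cod.coef b (\<phi> c) \<noteq> 0 \<longrightarrow> (b, c) \<in> le)"
  using assms
proof (induction "card {c \<in> B. wt c = wt b \<and> (b, c) \<in> le}" arbitrary: b rule: less_induct)
  case less
  note b = less.prems
  define U where "U = {c. dom.coef (\<phi> b) c \<noteq> 0} - {b}"
  have finU: "finite U" by (simp add: U_def dom.finite_representation)
  have U: "c \<in> B" "(b, c) \<in> le" "wt c = wt b" "c \<noteq> b" if "c \<in> U" for c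
    using that coef_triangular[OF b] dom.representation_ne_zero by (auto simp: U_def)
  have bb: "(b, b) \<in> le" using coef_triangular[OF b, of b] coef_diag[OF b] by simp
  have IH: "cod.coef c (\<phi> d) \<noteq> 0 \<Longrightarrow> d \<in> B \<Longrightarrow> (c, d) \<in> le" if c: "c \<in> U" for c d
  proof -
    have "{d \<in> B. wt d = wt c \<and> (c, d) \<in> le} \<subset> {d \<in> B. wt d = wt b \<and> (b, d) \<in> le}"
    proof (rule psubsetI)
      show "{d \<in> B. wt d = wt c \<and> (c, d) \<in> le} \<subseteq> {d \<in> B. wt d = wt b \<and> (b, d) \<in> le}"
        using U[OF c] trans_le by (auto dest: transD)
      have "(c, b) \<notin> le" using U[OF c] antisym_le by (meson antisymD)
      then show "{d \<in> B. wt d = wt c \<and> (c, d) \<in> le} \<noteq> {d \<in> B. wt d = wt b \<and> (b, d) \<in> le}"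
        using b bb by blast
    qed
    moreover have "finite {d \<in> B. wt d = wt b \<and> (b, d) \<in> le}"
      by (rule finite_subset[OF _ finite_block[of "wt b"]]) auto
    ultimately have "card {d \<in> B. wt d = wt c \<and> (c, d) \<in> le} < card {d \<in> B. wt d = wt b \<and> (b, d) \<in> le}"
      by (rule psubset_card_mono[rotated])
    from less.hyps[OF this U(1)[OF c]]
    show "cod.coef c (\<phi> d) \<noteq> 0 \<Longrightarrow> d \<in> B \<Longrightarrow> (c, d) \<in> le" by blast
  qed
  have "\<phi> b = (\<Sum>c | dom.coef (\<phi> b) c \<noteq> 0. dom.coef (\<phi> b) c *s c)"
    by (rule dom.expansion[symmetric])
  also have "\<dots> = b + (\<Sum>c\<in>U. dom.coef (\<phi> b) c *s c)"
    unfolding U_def using coef_diag[OF b]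
    by (subst sum.remove[where x = b]) (auto simp: dom.finite_representation)
  finally have expand: "b = \<phi> b - (\<Sum>c\<in>U. dom.coef (\<phi> b) c *s c)"
    by (metis add_diff_cancel_right')
  have coef_b: "cod.coef b y
      = cod.coef (\<phi> b) y - (\<Sum>c\<in>U. dom.coef (\<phi> b) c * cod.coef c y)" for y
  proof -
    have "cod.coef b y = cod.coef (\<phi> b - (\<Sum>c\<in>U. dom.coef (\<phi> b) c *s c)) y"
      using expand by simp
    then show ?thesis by (simp add: cod.coef_sum)
  qed
  \<comment> \<open>Were \<open>\<phi> b\<close> to occur in some \<open>c\<close> of
    \<open>U\<close>, the induction hypothesis would put \<open>c\<close> below \<open>b\<close>. So
    the diagonal coefficient comes from \<open>\<phi> b\<close> alone.\<close>
  have "cod.coef c (\<phi> b) = 0" if "c \<in> U" for c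
    using IH[OF that, of b] U[OF that] b antisym_le by (meson antisymD)
  then have "cod.coef b (\<phi> b) = 1"
    using \<phi>_in[OF b] by (simp add: coef_b cod.coef_basis)
  moreover have "(b, d) \<in> le" if d: "d \<in> B" and ne: "cod.coef b (\<phi> d) \<noteq> 0" for d
  proof (cases "d = b")
    case True
    then show ?thesis using bb by simp
  next
    case False
    then have "(\<Sum>c\<in>U. dom.coef (\<phi> b) c * cod.coef c (\<phi> d)) \<noteq> 0"
      using ne \<phi>_in[OF b] \<phi>_eq_iff[OF d b] by (simp add: coef_b cod.coef_basis)
    then obtain c where "c \<in> U" "cod.coef c (\<phi> d) \<noteq> 0"
      by (auto elim!: sum.not_neutral_contains_not_neutral)
    then show ?thesis using IH d U(2) trans_le by (meson transD)
  qed
  ultimately show ?case by blast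
qed

text \<open>\<open>b\<close> occurs in the expansion of \<open>\<phi> b\<close> in \<open>B\<close>,
  and \<open>\<phi> b\<close> in that of \<open>b\<close> in \<open>B'\<close>. A power of
  \<open>e\<close> killing a vector kills its support, which gives both directions.\<close>

lemma funpow_\<phi>_eq_0_iff:
  assumes "b \<in> B"
  shows "(e ^^ n) (\<phi> b) = 0 \<longleftrightarrow> (e ^^ n) b = 0"
  using dom.funpow_eq_0_support[of n "\<phi> b" b] cod.funpow_eq_0_support[of n b "\<phi> b"]
    coef_diag[OF assms] inverse_unitriangular[OF assms] by auto

text \<open>Up to vectors killed by \<open>e ^^ m\<close>, \<open>e (\<phi> b)\<close> is both a
  multiple of \<open>\<phi> d\<close> and a combination of elements \<open>t c\<close> with
  \<open>c\<close> in the support of \<open>\<phi> b\<close>. Coefficients at \<open>d\<close> give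
  the first claim, those at \<open>t b\<close> the other two.\<close>

lemma t_\<phi>_support:
  assumes b: "b \<in> B" and ne: "(e ^^ Suc m) b \<noteq> 0" and z: "(e ^^ Suc (Suc m)) b = 0"
    and d: "d \<in> B" and td: "t' (\<phi> b) = \<phi> d"
  shows "\<exists>c\<in>B. (e ^^ Suc m) c \<noteq> 0 \<and> (e ^^ Suc (Suc m)) c = 0 \<and> d = t c"
    and "(d, t b) \<in> le" and "wt d = wt (t b)"
proof -
  have z\<phi>: "(e ^^ Suc (Suc m)) (\<phi> b) = 0" and ne\<phi>: "(e ^^ Suc m) (\<phi> b) \<noteq> 0"
    using funpow_\<phi>_eq_0_iff[OF b] ne z by blast+
  from cod.depth_step[OF \<phi>_in[OF b] ne\<phi> z\<phi>] obtain a where a: "a \<noteq> 0"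
    and rest: "(e ^^ m) (e (\<phi> b) - a *s \<phi> d) = 0" and d\<phi>: "(e ^^ m) (\<phi> d) \<noteq> 0"
    unfolding td .
  have dm: "(e ^^ m) d \<noteq> 0" using d\<phi> funpow_\<phi>_eq_0_iff[OF d] by simp
  have coef_eq: "dom.coef (e (\<phi> b)) y = a * dom.coef (\<phi> d) y" if "(e ^^ m) y \<noteq> 0" for y
    using dom.funpow_eq_0_support[OF rest, of y] that by auto
  have supp: "c \<in> B" "(e ^^ Suc (Suc m)) c = 0" if "dom.coef (\<phi> b) c \<noteq> 0" for c
    using that dom.funpow_eq_0_support[OF z\<phi>] dom.representation_ne_zero by blast+
  have coef_e: "dom.coef (e (\<phi> b)) y
      = (\<Sum>c | dom.coef (\<phi> b) c \<noteq> 0. dom.coef (\<phi> b) c * dom.coef (e c) y)" for y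
    using dom.funpow_expansion[of 1 "\<phi> b"] by (simp add: dom.coef_sum)
  have "dom.coef (e (\<phi> b)) d \<noteq> 0"
    using coef_eq[OF dm] a coef_diag[OF d] by simp
  then obtain c where c: "dom.coef (\<phi> b) c \<noteq> 0" "dom.coef (e c) d \<noteq> 0"
    unfolding coef_e by (auto elim!: sum.not_neutral_contains_not_neutral)
  then show "\<exists>c\<in>B. (e ^^ Suc m) c \<noteq> 0 \<and> (e ^^ Suc (Suc m)) c = 0 \<and> d = t c"
    using supp[of c] dom.coef_e_nonzero_iff[of c m d] dm by blast
  from dom.depth_step[OF b ne z] have tb: "t b \<in> B" and tbm: "(e ^^ m) (t b) \<noteq> 0"
    by blast+
  \<comment> \<open>At \<open>t b\<close> only \<open>c = b\<close> contributes, since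
    \<open>t\<close> is injective where nonzero; so nothing can cancel it.\<close>
  have "dom.coef (e c) (t b) = 0" if c: "dom.coef (\<phi> b) c \<noteq> 0" "c \<noteq> b" for c
  proof (rule ccontr)
    assume "dom.coef (e c) (t b) \<noteq> 0"
    then have "t b = t c"
      using supp[OF c(1)] dom.coef_e_nonzero_iff tbm by blast
    then show False
      using dom.t_inj[OF b supp(1)[OF c(1)]] tb dom.zero_notin c(2) by metis
  qed
  then have "dom.coef (e (\<phi> b)) (t b)
      = (\<Sum>c\<in>{b}. dom.coef (\<phi> b) c * dom.coef (e c) (t b))"
    unfolding coef_e using coef_diag[OF b] dom.finite_representation
    by (intro sum.mono_neutral_right) auto
  also have "\<dots> \<noteq> 0"
    using coef_diag[OF b] dom.coef_e_nonzero_iff[OF b z tbm] ne by simp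
  finally have "dom.coef (\<phi> d) (t b) \<noteq> 0"
    using coef_eq[OF tbm] by auto
  then show "(d, t b) \<in> le" and "wt d = wt (t b)"
    using coef_triangular[OF d] by auto
qed

text \<open>The claim is that the map from \<open>t c\<close> to \<open>d c\<close>, where
  \<open>\<phi> (d c) = t' (\<phi> c)\<close>, fixes \<open>t b\<close>. It is decreasing by
  \<open>t_\<phi>_support\<close>, injective, and preserves a finite block, so
  \<open>injective_decreasing_eq\<close> applies.\<close>

lemma t_\<phi>_nonzero:
  assumes b: "b \<in> B" and ne: "(e ^^ Suc m) b \<noteq> 0" and z: "(e ^^ Suc (Suc m)) b = 0"
  shows "t' (\<phi> b) = \<phi> (t b)"
proof -
  \<comment> \<open>\<open>L\<close> is the layer of \<open>b\<close>; by
    \<open>funpow_\<phi>_eq_0_iff\<close>, \<open>\<phi>\<close> sends it to the layer of the same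
    depth in \<open>B'\<close>.\<close>
  define L where "L = {c \<in> B. (e ^^ Suc m) c \<noteq> 0 \<and> (e ^^ Suc (Suc m)) c = 0}"
  have tB: "t c \<in> B" if "c \<in> L" for c
    using that by (auto simp: L_def elim: dom.depth_step simp del: funpow.simps)
  have t_inj_L: "c = c'" if "c \<in> L" "c' \<in> L" "t c = t c'" for c c'
    using dom.t_inj[of c c'] tB[OF that(1)] dom.zero_notin that unfolding L_def by (metis (no_types, lifting) mem_Collect_eq)
  have t'B: "t' (\<phi> c) \<in> B'" if "c \<in> L" for c
    using that cod.depth_step[of "\<phi> c" m] \<phi>_in[of c] funpow_\<phi>_eq_0_iff[of c]
    by (auto simp: L_def simp del: funpow.simps)
  define d where "d c = inv_into B \<phi> (t' (\<phi> c))" for c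
  have \<phi>B: "\<phi> ` B = B'" using bij by (simp add: bij_betw_def)
  have dB: "d c \<in> B" and \<phi>d: "\<phi> (d c) = t' (\<phi> c)" if "c \<in> L" for c
    using t'B[OF that] \<phi>B by (auto simp: d_def inv_into_into f_inv_into_f)
  have d_props: "d c \<in> t ` L" "(d c, t c) \<in> le" "wt (d c) = wt (t c)" if "c \<in> L" for c
    using t_\<phi>_support[of c m "d c"] dB[OF that] \<phi>d[OF that] that
    by (auto simp: L_def image_iff simp del: funpow.simps)
  have d_inj: "c = c'" if "c \<in> L" "c' \<in> L" "d c = d c'" for c c'
  proof -
    have "t' (\<phi> c) = t' (\<phi> c')" using \<phi>d that by metis
    then have "\<phi> c = \<phi> c'"
      using cod.t_inj t'B[OF that(1)] cod.zero_notin \<phi>_in that by (metis (no_types, lifting) L_def mem_Collect_eq)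
    then show ?thesis using \<phi>_eq_iff that by (auto simp: L_def)
  qed
  define S where "S = {y \<in> t ` L. wt y = wt (t b)}"
  define \<tau> where "\<tau> y = d (inv_into L t y)" for y
  have \<tau>: "\<tau> (t c) = d c" if "c \<in> L" for c
    using that t_inj_L by (simp add: \<tau>_def inv_into_f_f inj_on_def)
  have bL: "b \<in> L" using b ne z by (simp add: L_def)
  have "\<tau> (t b) = t b"
  proof (rule injective_decreasing_eq[where S = S and r = le])
    show "finite S"
      by (rule finite_subset[OF _ finite_block[of "wt (t b)"]]) (use tB in \<open>auto simp: S_def\<close>)
    show "\<tau> ` S \<subseteq> S" using \<tau> d_props by (auto simp: S_def)
    show "inj_on \<tau> S" 
    proof (rule inj_onI)
      fix y y' assume y: "y \<in> S" "y' \<in> S" "\<tau> y = \<tau> y'"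
      then obtain c c' where "c \<in> L" "y = t c" "c' \<in> L" "y' = t c'" by (auto simp: S_def)
      then show "y = y'" using y(3) \<tau> d_inj by metis
    qed
    show "(\<tau> y, y) \<in> le" if "y \<in> S" for y using that \<tau> d_props by (auto simp: S_def)
    show "t b \<in> S" using bL by (auto simp: S_def)
  qed (rule trans_le antisym_le)+
  then show ?thesis using \<tau>[OF bL] \<phi>d[OF bL] by simp
qed

lemma t_\<phi>:
  assumes b: "b \<in> B"
  shows "t' (\<phi> b) = extend_by_0 \<phi> (t b)"
proof (cases "e b = 0")
  case True
  then have "e (\<phi> b) = 0" using funpow_\<phi>_eq_0_iff[OF b, of 1] by simp
  then show ?thesis
    using True dom.top[OF b] cod.top[OF \<phi>_in[OF b]] by (simp add: extend_by_0_def)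
next
  case False
  then obtain m where "(e ^^ m) (e b) \<noteq> 0" "(e ^^ Suc m) (e b) = 0"
    by (rule dom.depth_ex)
  then have m: "(e ^^ Suc m) b \<noteq> 0" "(e ^^ Suc (Suc m)) b = 0"
    by (simp_all add: funpow_Suc_right del: funpow.simps)
  have "t b \<in> B" using dom.depth_step[OF b m] by blast
  then show ?thesis
    using t_\<phi>_nonzero[OF b m] dom.zero_notin by (auto simp: extend_by_0_def)
qed

text \<open>\<open>\<phi>\<close> carries the fibre of \<open>t\<close> over \<open>b\<close> onto
  the fibre of \<open>t'\<close> over \<open>\<phi> b\<close>, and each has at most one element. So
  the two descriptions match, and the default \<open>0\<close> occurs on both sides
  together.\<close>

lemma f_tilde_\<phi>:
  assumes b: "b \<in> B"
  shows "(if \<exists>c\<in>B'. t' c = \<phi> b then THE c. c \<in> B' \<and> t' c = \<phi> b else 0)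
    = extend_by_0 \<phi> (if \<exists>c\<in>B. t c = b then THE c. c \<in> B \<and> t c = b else 0)"
proof -
  have iff: "t' (\<phi> c) = \<phi> b \<longleftrightarrow> t c = b" if c: "c \<in> B" for c
  proof (cases "t c = 0")
    case True
    then show ?thesis
      using t_\<phi>[OF c] b dom.zero_notin cod.zero_notin \<phi>_in[OF b] by (auto simp: extend_by_0_def)
  next
    case False
    then have "e c \<noteq> 0" using dom.top[OF c] by blast
    then obtain m where "(e ^^ m) (e c) \<noteq> 0" "(e ^^ Suc m) (e c) = 0"
      by (rule dom.depth_ex)
    then have "t c \<in> B"
      using dom.depth_step[OF c, of m] by (simp add: funpow_Suc_right del: funpow.simps)
    then show ?thesis
      using t_\<phi>[OF c] False \<phi>_eq_iff[OF _ b] by (simp add: extend_by_0_def)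
  qed
  have \<phi>B: "B' = \<phi> ` B" using bij by (simp add: bij_betw_def)
  show ?thesis
  proof (cases "\<exists>c\<in>B. t c = b")
    case True
    then obtain c where c: "c \<in> B" "t c = b" by blast
    have "(THE c. c \<in> B \<and> t c = b) = c"
    proof (rule the_equality)
      show "c \<in> B \<and> t c = b" using c by blast
      show "c' = c" if "c' \<in> B \<and> t c' = b" for c'
        using dom.t_inj[of c' c] that c b dom.zero_notin by metis
    qed
    moreover have "(THE c. c \<in> B' \<and> t' c = \<phi> b) = \<phi> c"
    proof (rule the_equality)
      show *: "\<phi> c \<in> B' \<and> t' (\<phi> c) = \<phi> b" using c iff \<phi>_in by blast
      show "c' = \<phi> c" if "c' \<in> B' \<and> t' c' = \<phi> b" for c'
        using cod.t_inj[of c' "\<phi> c"] that * \<phi>_in[OF b] cod.zero_notin by metis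
    qed
    moreover have "\<exists>c\<in>B'. t' c = \<phi> b" using c iff \<phi>_in by blast
    moreover have "c \<noteq> 0" using c dom.zero_notin by blast
    ultimately show ?thesis using True by (simp add: extend_by_0_def)
  next
    case False
    then have "\<not> (\<exists>c\<in>B'. t' c = \<phi> b)" using iff \<phi>B by auto
    then show ?thesis using False by (simp add: extend_by_0_def)
  qed
qed

end

section \<open>Perfect bases\<close>

lemma linear_chevalley_e:
  assumes "lie_module (kac_moody D) M"
  shows "Vector_Spaces.linear (vscale M) (vscale M) (act M (chevalley_e D i))"
  using assms
  by (auto simp: lie_module_def chevalley_e_def kac_moody_def presented_lie_algebra_simps)

text \<open>Links the \<open>Max\<close> in \<open>ell\<close> to vanishing conditions as in
  \<open>adapted_basis\<close>: once a power kills \<open>x\<close>, all later ones do.\<close>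

lemma ell_eqI:
  assumes M: "lie_module (kac_moody D) M"
    and ne: "(act M (chevalley_e D i) ^^ m) x \<noteq> 0"
    and z: "(act M (chevalley_e D i) ^^ Suc m) x = 0"
  shows "ell D M i x = Fin (int m)"
proof -
  interpret Vector_Spaces.linear "vscale M" "vscale M" "act M (chevalley_e D i)"
    by (rule linear_chevalley_e[OF M])
  have zero: "(act M (chevalley_e D i) ^^ k) 0 = 0" for k
    by (induction k) (simp_all add: zero)
  have "(act M (chevalley_e D i) ^^ k) x = 0" if "Suc m \<le> k" for k
    using z zero that by (metis comp_apply funpow_add le_add_diff_inverse2)
  then have le: "k \<le> m" if "(act M (chevalley_e D i) ^^ k) x \<noteq> 0" for k
    using that not_less_eq_eq by blast
  then have "Max {k. (act M (chevalley_e D i) ^^ k) x \<noteq> 0} = m"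
    using ne by (intro Max_eqI) (auto intro: finite_subset[of _ "{..m}"])
  moreover have "x \<noteq> 0" using ne zero by blast
  ultimately show ?thesis by (simp add: ell_def)
qed

text \<open>The work lies mainly in \<open>step\<close>: for \<open>b\<close> of depth
  \<open>Suc m\<close> the correction \<open>v\<close> has \<open>ell\<close> below
  \<open>m\<close>. If the \<open>m\<close>-th power did not kill it, the first exponent that does
  would exceed \<open>m\<close> and \<open>ell\<close> would be at least \<open>m\<close>.\<close>

lemma adapted_basis_perfect_basis:
  assumes O: "M \<in> O_int D" and B: "perfect_basis D M B \<e>"
  shows "adapted_basis (vscale M) (act M (chevalley_e D i)) B (\<e> i)"
proof -
  let ?e = "act M (chevalley_e D i)"
  have M: "lie_module (kac_moody D) M" using O by (simp add: O_int_def)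
  interpret vector_space "vscale M" using M by (simp add: lie_module_def)
  interpret lin: Vector_Spaces.linear "vscale M" "vscale M" ?e
    by (rule linear_chevalley_e[OF M])
  have zero: "(?e ^^ k) 0 = 0" for k by (induction k) (simp_all add: lin.zero)
  have nilp: "\<exists>k. (?e ^^ k) v = 0" for v using O by (simp add: O_int_def)
  have indep: "independent B" using B by (simp add: perfect_basis_def)
  show ?thesis
  proof unfold_locales
    show "\<exists>n. (?e ^^ n) v = 0" for v by (rule nilp)
    show "independent B" by (rule indep)
    show "span B = UNIV" using B by (simp add: perfect_basis_def)
    show "\<e> i b = 0" if b: "b \<in> B" and z: "?e b = 0" for b
    proof -
      have "b \<noteq> 0" using b indep dependent_zero by blast
      then have "ell D M i b = 0"
        using ell_eqI[OF M, where m = 0 and x = b and i = i] z by (simp add: zero_extended_def)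
      then show ?thesis using B b by (auto simp: perfect_basis_def)
    qed
    show "\<e> i b \<in> B \<and> (\<exists>a. a \<noteq> 0 \<and> (?e ^^ m) (?e b - vscale M a (\<e> i b)) = 0)"
      if b: "b \<in> B" and ne: "(?e ^^ Suc m) b \<noteq> 0" and z: "(?e ^^ Suc (Suc m)) b = 0" for b m
    proof -
      have ell: "ell D M i b = Fin (int (Suc m))" by (rule ell_eqI[OF M ne z])
      then have "ell D M i b > 0" by (simp add: zero_extended_def)
      then obtain a v where a: "\<e> i b \<in> B" "a \<noteq> 0" "v \<in> V_less D M i (ell D M i b - 1)"
        "?e b = vscale M a (\<e> i b) + v"
        using B b unfolding perfect_basis_def by blast
      have lt: "ell D M i v < Fin (int m)"
        using a(3) ell by (simp add: V_less_def one_extended_def)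
      have "(?e ^^ m) v = 0"
      proof (rule ccontr)
        assume nz: "(?e ^^ m) v \<noteq> 0"
        obtain n where n: "(?e ^^ n) v = 0" using nilp by blast
        define k where "k = (LEAST k. (?e ^^ k) v = 0)"
        have k: "(?e ^^ k) v = 0" "\<And>j. j < k \<Longrightarrow> (?e ^^ j) v \<noteq> 0"
          using n LeastI[of "\<lambda>k. (?e ^^ k) v = 0"] not_less_Least unfolding k_def by blast+
        have "m < k"
        proof (rule ccontr)
          assume "\<not> m < k"
          then have "(?e ^^ m) v = (?e ^^ (m - k)) ((?e ^^ k) v)"
            by (metis comp_apply funpow_add le_add_diff_inverse2 not_less)
          then show False using nz k(1) zero by simp
        qed
        then obtain k' where k': "k = Suc k'" "m \<le> k'" by (cases k) auto
        then have "ell D M i v = Fin (int k')" using k by (intro ell_eqI[OF M]) auto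
        then show False using lt k' by simp
      qed
      then show ?thesis using a by auto
    qed
    show "b = b'" if "b \<in> B" "b' \<in> B" "\<e> i b = \<e> i b'" "\<e> i b \<noteq> 0" for b b'
      using B that unfolding perfect_basis_def by blast
  qed
qed

section \<open>Weights of basis elements and supports of weight vectors\<close>

lemma basis_wt_eqI:
  assumes B: "perfect_basis D M B \<e>" and b: "b \<in> B" "b \<in> weight_space D M \<mu>"
  shows "basis_wt D M b = \<mu>"
  unfolding basis_wt_def
proof (rule the_equality)
  show "b \<in> weight_space D M \<mu>" by (rule b)
  have "disjoint_family (\<lambda>\<mu>. B \<inter> weight_space D M \<mu>)" using B by (simp add: perfect_basis_def)
  then show "\<nu> = \<mu>" if "b \<in> weight_space D M \<nu>" for \<nu>
    using b that by (auto simp: disjoint_family_on_def)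
qed

lemma in_weight_space_basis_wt:
  assumes B: "perfect_basis D M B \<e>" and b: "b \<in> B"
  shows "b \<in> weight_space D M (basis_wt D M b)"
proof -
  have "B = (\<Union>\<mu>. B \<inter> weight_space D M \<mu>)" using B by (simp add: perfect_basis_def)
  then obtain \<mu> where "b \<in> weight_space D M \<mu>" using b by blast
  then show ?thesis using basis_wt_eqI[OF B b] by simp
qed

text \<open>Each \<open>cartan_h D h\<close> acts diagonally on \<open>B\<close>. Comparing
  coefficients at \<open>c\<close> in its action on \<open>x\<close> shows that \<open>c\<close> has
  the eigenvalue prescribed by \<open>\<mu>\<close>, so \<open>c\<close> lies in that weight
  space.\<close>

lemma support_weight:
  assumes M: "lie_module (kac_moody D) M" and B: "perfect_basis D M B \<e>"
    and x: "x \<in> weight_space D M \<mu>" and c: "module.representation (vscale M) B x c \<noteq> 0"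
  shows "basis_wt D M c = \<mu>"
proof -
  interpret vector_space "vscale M" using M by (simp add: lie_module_def)
  have indep: "independent B" and sp: "span B = UNIV" using B by (auto simp: perfect_basis_def)
  have cB: "c \<in> B" using c representation_ne_zero by blast
  let ?r = "representation B"
  have "act M (cartan_h D h) c = vscale M (of_int (pairing D h \<mu>)) c" for h
  proof -
    let ?h = "act M (cartan_h D h)" and ?p = "\<lambda>b. of_int (pairing D h (basis_wt D M b)) :: complex"
    have "Vector_Spaces.linear (vscale M) (vscale M) ?h"
      using M by (auto simp: lie_module_def cartan_h_def kac_moody_def presented_lie_algebra_simps)
    then interpret h: Vector_Spaces.linear "vscale M" "vscale M" ?h .
    have hb: "?h b = vscale M (?p b) b" if "b \<in> B" for b
      using in_weight_space_basis_wt[OF B that] by (simp add: weight_space_def)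
    have "?h x = ?h (\<Sum>b | ?r x b \<noteq> 0. vscale M (?r x b) b)"
      using sum_nonzero_representation_eq[OF indep, of x] sp by simp
    also have "\<dots> = (\<Sum>b | ?r x b \<noteq> 0. vscale M (?r x b * ?p b) b)"
      unfolding h.sum
      by (intro sum.cong) (auto simp: h.scale hb dest!: representation_ne_zero)
    finally have "?r (?h x) c = (\<Sum>b | ?r x b \<noteq> 0. ?r (vscale M (?r x b * ?p b) b) c)"
      using sp by (simp add: representation_sum[OF indep])
    also have "\<dots> = (\<Sum>b | ?r x b \<noteq> 0. if b = c then ?r x b * ?p b else 0)"
    proof (rule sum.cong[OF HOL.refl])
      fix b assume "b \<in> {b. ?r x b \<noteq> 0}"
      then have "b \<in> B" using representation_ne_zero by blast
      then show "?r (vscale M (?r x b * ?p b) b) c = (if b = c then ?r x b * ?p b else 0)"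
        using sp by (simp add: representation_scale[OF indep] representation_basis[OF indep])
    qed
    also have "\<dots> = ?r x c * ?p c"
      using c finite_representation by simp
    finally have "?r x c * ?p c = ?r (?h x) c" by simp
    also have "\<dots> = of_int (pairing D h \<mu>) * ?r x c"
      using x sp by (simp add: weight_space_def representation_scale[OF indep])
    finally have "?p c = of_int (pairing D h \<mu>)" using c by simp
    then show ?thesis using hb[OF cB] by simp
  qed
  then have "c \<in> weight_space D M \<mu>" by (simp add: weight_space_def)
  then show ?thesis by (rule basis_wt_eqI[OF B cB])
qed

section \<open>The crystal isomorphism\<close>

theorem proposition1p14:
  fixes D :: "('i, 'x :: ab_group_add, 'y :: ab_group_add) cartan_data"
    and M :: "(('i, 'y) km_elem, 'v :: ab_group_add) lie_rep"
    and B B' :: "'v set" and \<e> \<e>' :: "'i \<Rightarrow> 'v \<Rightarrow> 'v"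
    and \<phi> :: "'v \<Rightarrow> 'v" and le :: "'v rel"
  assumes "cartan_datum D"
    and "M \<in> O_int D"
    and "perfect_basis D M B \<e>"
    and "perfect_basis D M B' \<e>'"
    and "bij_betw \<phi> B B'"
    and "partial_order_on B le"
    and "\<And>b. b \<in> B \<Longrightarrow>
           \<exists>v \<in> module.span (vscale M) {c \<in> B. (b, c) \<in> le \<and> c \<noteq> b}. \<phi> b = b + v"
  shows "crystal_iso (crystal_of D M B \<e>) (crystal_of D M B' \<e>') \<phi>"
proof -
  note O = assms(2) and B = assms(3) and B' = assms(4) and bij = assms(5)
  have M: "lie_module (kac_moody D) M" using O by (simp add: O_int_def)
  interpret vector_space "vscale M" using M by (simp add: lie_module_def)
  have indep: "independent B" "independent B'" and sp: "span B = UNIV"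
    using B B' by (auto simp: perfect_basis_def)
  have zero: "0 \<notin> B" "0 \<notin> B'" using indep dependent_zero by blast+
  let ?r = "representation B"
  have diag: "?r (\<phi> b) b = 1" and above: "?r (\<phi> b) c \<noteq> 0 \<Longrightarrow> (b, c) \<in> le" if b: "b \<in> B" for b c
  proof -
    let ?U = "{c \<in> B. (b, c) \<in> le \<and> c \<noteq> b}"
    obtain v where v: "v \<in> span ?U" "\<phi> b = b + v" using assms(7)[OF b] by blast
    \<comment> \<open>Coordinates of \<open>v\<close> in \<open>B\<close> agree with those in the
      subset spanning it; thus \<open>v\<close> is supported strictly above
      \<open>b\<close>.\<close>
    have "?r v = representation ?U v"
      by (rule representation_extend[OF indep(1) v(1)]) auto
    then have rv: "?r v c \<noteq> 0 \<Longrightarrow> c \<in> ?U" for c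
      using representation_ne_zero[of ?U v c] by simp
    have r: "?r (\<phi> b) c = (if c = b then 1 else 0) + ?r v c" for c
      using sp b v(2) by (simp add: representation_add[OF indep(1)] representation_basis[OF indep(1)])
    show "?r (\<phi> b) b = 1" using r[of b] rv[of b] by auto
    have "(b, b) \<in> le"
      using b assms(6) by (auto simp: partial_order_on_def preorder_on_def refl_on_def)
    then show "?r (\<phi> b) c \<noteq> 0 \<Longrightarrow> (b, c) \<in> le"
      using r[of c] rv[of c] by (auto split: if_splits)
  qed
  \<comment> \<open>\<open>\<phi> b\<close> lies in \<open>B'\<close> and so is a weight vector; its
    whole support in \<open>B\<close> has that weight.\<close>
  have supp_wt: "basis_wt D M c = basis_wt D M (\<phi> b)" if "b \<in> B" "?r (\<phi> b) c \<noteq> 0" for b c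
  proof -
    have "\<phi> b \<in> B'" using that bij bij_betwE by blast
    then have "\<phi> b \<in> weight_space D M (basis_wt D M (\<phi> b))" by (rule in_weight_space_basis_wt[OF B'])
    then show ?thesis using that(2) by (rule support_weight[OF M B])
  qed
  \<comment> \<open>By \<open>diag\<close>, \<open>b\<close> itself lies in the support of
    \<open>\<phi> b\<close>.\<close>
  have wt: "basis_wt D M (\<phi> b) = basis_wt D M b" if "b \<in> B" for b
    by (rule supp_wt[symmetric]) (simp_all add: that diag)
  have finite_block: "finite {c \<in> B. basis_wt D M c = \<mu>}" for \<mu>
  proof -
    have "\<forall>\<omega>. \<exists>T. finite T \<and> span T = weight_space D M \<omega>"
      using O by (simp add: O_int_def)
    then obtain T where T: "finite T" "span T = weight_space D M \<mu>" by blast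
    have "{c \<in> B. basis_wt D M c = \<mu>} \<subseteq> span T"
      using in_weight_space_basis_wt[OF B] T(2) by auto
    moreover have "independent {c \<in> B. basis_wt D M c = \<mu>}"
      by (rule independent_mono[OF indep(1)]) auto
    ultimately show ?thesis using independent_span_bound[OF T(1)] by blast
  qed
  have unitriangular: "unitriangular_bases (vscale M) (act M (chevalley_e D i)) B (\<e> i) B' (\<e>' i)
      \<phi> le (basis_wt D M)" for i
  proof -
    interpret dom: adapted_basis "vscale M" "act M (chevalley_e D i)" B "\<e> i"
      by (rule adapted_basis_perfect_basis[OF O B])
    interpret cod: adapted_basis "vscale M" "act M (chevalley_e D i)" B' "\<e>' i"
      by (rule adapted_basis_perfect_basis[OF O B'])
    show ?thesis
    proof unfold_locales
      show "trans le" "antisym le"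
        using assms(6) by (auto simp: partial_order_on_def preorder_on_def)
      show "(b, c) \<in> le \<and> basis_wt D M c = basis_wt D M b"
        if "b \<in> B" "?r (\<phi> b) c \<noteq> 0" for b c
        using that above supp_wt wt by metis
    qed (simp_all add: bij finite_block diag)
  qed
  have eps: "ell D M i (\<phi> b) = ell D M i b" if b: "b \<in> B" for i b
  proof -
    interpret unitriangular_bases "vscale M" "act M (chevalley_e D i)" B "\<e> i" B' "\<e>' i"
      \<phi> le "basis_wt D M" by (rule unitriangular)
    show ?thesis
      using zero b \<phi>_in[OF b] by (auto simp: ell_def funpow_\<phi>_eq_0_iff[OF b])
  qed
  \<comment> \<open>Equality of \<open>phi\<close> follows from \<open>eps\<close> and
    \<open>wt\<close>, since \<open>phi\<close> is \<open>ell\<close> plus the pairing of the coroot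
    with the weight.\<close>
  show ?thesis
    unfolding crystal_iso_def crystal_of_def
    using zero bij wt eps unitriangular_bases.t_\<phi>[OF unitriangular]
      unitriangular_bases.f_tilde_\<phi>[OF unitriangular]
    by simp
qed

end
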